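(* There is an absolute constant $C>0$ such that the following holds. Let $n\ge 1$ and let $X$ be a (weighted) graph of order $n$ with Hermitian adjacency matrix $A\in\mathbb{C}^{n\times n}$ such that $0$ is a simple eigenvalue of $A$ with corresponding eigenvector $\mathbf{1}_n$ (the all-one vector). Let $\widehat{X}=K_1+X$ be the cone of $X$, with adjacency matrix $$A(\widehat{X})=\begin{pmatrix}0&\mathbf{1}_n^T\\ \mathbf{1}_n&A\end{pmatrix}.$$ Then $\widehat{X}$ has probabilistic (Las Vegas) uniform mixing in expected time $O(n^{3/2})$: for every start vertex $u$ of $\widehat{X}$ there is a measured-walk protocol on $\widehat{X}$, with generator $H=\frac1n A(\widehat{X})$, which starts in the state $e_u$, stops with probability $1$, always stops in a uniform state, and whose expected total evolution time is at most $C\,n^{3/2}$.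
   Context: Weighted graphs are identified with their Hermitian adjacency matrices (complex weights allowed). The cone $\widehat{X}$ is obtained from $X$ by adding one new vertex (the conical vertex) joined to every vertex of $X$ by an edge of weight $1$. For a graph $Y$ with vertex set $V$, $|V|=N$, states are unit vectors in $\mathbb{C}^V$, and $e_v$ denotes the standard basis vector of $v\in V$. For a Hermitian generator $H$ on $\mathbb{C}^V$ (the adjacency matrix of $Y$ or a positive real multiple of it), evolving for time $t\ge0$ maps $\psi$ to $e^{-itH}\psi$. The partial measurement relative to a vertex $a$ uses the projections $P_1=e_ae_a^T$ and $P_0=I-e_ae_a^T$: applied to a state $\psi$ it returns outcome $j\in\{0,1\}$ with probability $\|P_j\psi\|^2$, after which the state is $P_j\psi/\|P_j\psi\|$. A measured-walk protocol is an adaptive sequence of steps, each being either an evolution for some chosen time $t\ge 0$ or an (instantaneous) partial measurement relative to some chosen vertex, together with a stopping rule; all choices may depend on the start vertex and on previous measurement outcomes. Its total evolution time is the random variable given by the sum of the durations of the evolution steps before stopping. A state $\psi$ is uniform if $|\psi(v)|^2=1/N$ for all $v\in V$. Times are measured with the adjacency matrix scaled by $1/n$ (so that the generator has bounded norm for unit-modulus weights). *)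

theory Defs
  imports "HOL-Probability.SPMF" "Jordan_Normal_Form.Schur_Decomposition"
begin

unbundle no vec_syntax

section \<open>Hermitian weighted graphs and cones\<close>

text \<open>
  A weighted graph of order \<open>n\<close> is its Hermitian adjacency matrix of dimension \<open>n\<close>; its
  vertices are \<open>0, \<dots>, n - 1\<close>.
\<close>

definition hermitian_mat :: "complex mat \<Rightarrow> bool" where
  "hermitian_mat A \<longleftrightarrow> square_mat A \<and> mat_adjoint A = A"

text \<open>Simple means algebraic multiplicity one.\<close>

definition simple_eigenvalue :: "complex mat \<Rightarrow> complex \<Rightarrow> bool" where
  "simple_eigenvalue A k \<longleftrightarrow> eigenvalue A k \<and> Polynomial.order k (char_poly A) = 1"

definition ones_vec :: "nat \<Rightarrow> complex vec" where
  "ones_vec n = Matrix.vec n (\<lambda>_. 1)"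

text \<open>Vertex \<open>0\<close> of the cone is the conical vertex; vertex \<open>v\<close> of the base becomes \<open>Suc v\<close>.\<close>

definition cone_mat :: "complex mat \<Rightarrow> complex mat" where
  "cone_mat A =
    (let n = dim_row A
     in four_block_mat (0\<^sub>m 1 1) (Matrix.mat 1 n (\<lambda>_. 1)) (Matrix.mat n 1 (\<lambda>_. 1)) A)"


section \<open>Evolution and partial measurement\<close>

text \<open>The power series of the exponential, taken entrywise (it converges for every matrix).\<close>

definition mat_exp :: "complex mat \<Rightarrow> complex mat" where
  "mat_exp M =
    Matrix.mat (dim_row M) (dim_row M) (\<lambda>(i, j). \<Sum>k. (M ^\<^sub>m k) $$ (i, j) / fact k)"

definition evolve :: "complex mat \<Rightarrow> real \<Rightarrow> complex vec \<Rightarrow> complex vec" where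
  "evolve H t \<psi> = mat_exp ((- \<i> * complex_of_real t) \<cdot>\<^sub>m H) *\<^sub>v \<psi>"

definition l2_norm :: "complex vec \<Rightarrow> real" where
  "l2_norm \<psi> = sqrt (\<Sum>v<dim_vec \<psi>. (cmod (\<psi> $ v))\<^sup>2)"

text \<open>\<open>proj N a True\<close> is \<open>P\<^sub>1\<close> and \<open>proj N a False\<close> is \<open>P\<^sub>0\<close>.\<close>

definition proj :: "nat \<Rightarrow> nat \<Rightarrow> bool \<Rightarrow> complex mat" where
  "proj N a b =
    (let P = Matrix.mat N N (\<lambda>(i, j). if i = a \<and> j = a then 1 else 0)
     in if b then P else 1\<^sub>m N - P)"

definition project :: "nat \<Rightarrow> bool \<Rightarrow> complex vec \<Rightarrow> complex vec" where
  "project a b \<psi> = proj (dim_vec \<psi>) a b *\<^sub>v \<psi>"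

text \<open>
  For a unit vector \<open>\<psi>\<close> the two squared norms below lie in \<open>[0, 1]\<close> and add up to \<open>1\<close>, so that
  the outcome \<open>False\<close> has probability \<open>(l2_norm (project a False \<psi>))\<^sup>2\<close>; see
  \<open>pmf_measurement\<close>.
\<close>

definition measurement :: "nat \<Rightarrow> complex vec \<Rightarrow> bool pmf" where
  "measurement a \<psi> = bernoulli_pmf ((l2_norm (project a True \<psi>))\<^sup>2)"

definition post_state :: "nat \<Rightarrow> bool \<Rightarrow> complex vec \<Rightarrow> complex vec" where
  "post_state a b \<psi> =
    complex_of_real (1 / l2_norm (project a b \<psi>)) \<cdot>\<^sub>v project a b \<psi>"

definition uniform_state :: "complex vec \<Rightarrow> bool" where
  "uniform_state \<psi> \<longleftrightarrow> (\<forall>v<dim_vec \<psi>. (cmod (\<psi> $ v))\<^sup>2 = 1 / real (dim_vec \<psi>))"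

lemma l2_norm_sq: "(l2_norm \<psi>)\<^sup>2 = (\<Sum>v<dim_vec \<psi>. (cmod (\<psi> $ v))\<^sup>2)"
  by (simp add: l2_norm_def sum_nonneg)

lemma project_index:
  assumes "v < dim_vec \<psi>"
  shows "project a b \<psi> $ v = (if (v = a) = b then \<psi> $ v else 0)"
proof -
  let ?N = "dim_vec \<psi>"
  let ?c = "if (v = a) = b then 1 else 0 :: complex"
  have entry: "proj ?N a b $$ (v, i) = (if i = v then ?c else 0)" if "i < ?N" for i
    using assms that by (auto simp: proj_def Let_def)
  have "project a b \<psi> $ v = (\<Sum>i = 0..<?N. proj ?N a b $$ (v, i) * \<psi> $ i)"
    using assms by (simp add: project_def proj_def Let_def scalar_prod_def)
  also have "\<dots> = (\<Sum>i = 0..<?N. if i = v then ?c * \<psi> $ i else 0)"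
    by (rule sum.cong) (simp_all add: entry)
  also have "\<dots> = ?c * \<psi> $ v"
    using assms by (subst sum.delta) simp_all
  finally show ?thesis by simp
qed

lemma dim_project [simp]: "dim_vec (project a b \<psi>) = dim_vec \<psi>"
  by (simp add: project_def proj_def Let_def)

lemma l2_norm_project_add:
  "(l2_norm (project a True \<psi>))\<^sup>2 + (l2_norm (project a False \<psi>))\<^sup>2 = (l2_norm \<psi>)\<^sup>2"
proof -
  have "(\<Sum>v<dim_vec \<psi>. (cmod (project a True \<psi> $ v))\<^sup>2) +
      (\<Sum>v<dim_vec \<psi>. (cmod (project a False \<psi> $ v))\<^sup>2) =
      (\<Sum>v<dim_vec \<psi>. (cmod (project a True \<psi> $ v))\<^sup>2 + (cmod (project a False \<psi> $ v))\<^sup>2)"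
    by (rule sum.distrib[symmetric])
  also have "\<dots> = (\<Sum>v<dim_vec \<psi>. (cmod (\<psi> $ v))\<^sup>2)"
    by (rule sum.cong) (simp_all add: project_index)
  finally show ?thesis by (simp only: l2_norm_sq dim_project)
qed

lemma pmf_measurement:
  assumes "l2_norm \<psi> = 1"
  shows "pmf (measurement a \<psi>) b = (l2_norm (project a b \<psi>))\<^sup>2"
proof -
  have *: "(l2_norm (project a True \<psi>))\<^sup>2 + (l2_norm (project a False \<psi>))\<^sup>2 = 1"
    using l2_norm_project_add[of a \<psi>] assms by simp
  then have "(l2_norm (project a True \<psi>))\<^sup>2 \<le> 1"
    using zero_le_power2[of "l2_norm (project a False \<psi>)"] by linarith
  with * show ?thesis
    by (cases b) (auto simp: measurement_def)
qed


section \<open>Measured-walk protocols\<close>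

text \<open>
  A protocol is a possibly infinite decision tree. In \<open>Measure a p1 p0\<close> the walk continues with
  \<open>p1\<close> after outcome \<open>1\<close> and with \<open>p0\<close> after outcome \<open>0\<close>, so that every choice, including when
  to stop, may depend on all previous outcomes.
\<close>

codatatype protocol =
    Stop
  | Evolve real protocol
  | Measure nat protocol protocol

coinductive valid_protocol :: "nat \<Rightarrow> protocol \<Rightarrow> bool" for N where
  "valid_protocol N Stop"
| "0 \<le> t \<Longrightarrow> valid_protocol N p \<Longrightarrow> valid_protocol N (Evolve t p)"
| "a < N \<Longrightarrow> valid_protocol N p1 \<Longrightarrow> valid_protocol N p0 \<Longrightarrow> valid_protocol N (Measure a p1 p0)"

text \<open>
  \<open>run H p \<psi> \<tau>\<close> is the joint distribution of the final state and the total evolution time when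
  \<open>p\<close> is executed from state \<open>\<psi>\<close> after time \<open>\<tau>\<close> has already elapsed. It is a subprobability
  distribution: the missing mass is the probability that the protocol never stops.
\<close>

partial_function (spmf) run ::
  "complex mat \<Rightarrow> protocol \<Rightarrow> complex vec \<Rightarrow> real \<Rightarrow> (complex vec \<times> real) spmf" where
  "run H p \<psi> \<tau> =
    (case p of
       Stop \<Rightarrow> return_spmf (\<psi>, \<tau>)
     | Evolve t p' \<Rightarrow> run H p' (evolve H t \<psi>) (\<tau> + t)
     | Measure a p1 p0 \<Rightarrow>
         bind_pmf (measurement a \<psi>)
           (\<lambda>b. run H (if b then p1 else p0) (post_state a b \<psi>) \<tau>))"

definition expected_time :: "(complex vec \<times> real) spmf \<Rightarrow> ennreal" where
  "expected_time r = (\<integral>\<^sup>+ x. ennreal (snd x) \<partial>measure_spmf r)"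

text \<open>
  Probabilistic (Las Vegas) uniform mixing under the generator \<open>H\<close> in expected time at most \<open>T\<close>.
\<close>

definition las_vegas_uniform_mixing :: "complex mat \<Rightarrow> real \<Rightarrow> bool" where
  "las_vegas_uniform_mixing H T \<longleftrightarrow>
    (\<forall>u<dim_row H. \<exists>p. valid_protocol (dim_row H) p \<and>
      (let r = run H p (unit_vec (dim_row H) u) 0
       in lossless_spmf r \<and>
          (\<forall>(\<psi>, \<tau>)\<in>set_spmf r. uniform_state \<psi>) \<and>
          expected_time r \<le> ennreal T))"

end

theory Submission
  imports Defs
begin

text \<open>
  Since \<open>A\<close> annihilates the all-one vector, the plane spanned by the conical vertex \<open>e\<^sub>0\<close> and
  \<open>\<one>/\<surd>n\<close> is invariant, and \<open>H = A(X)/n\<close> (\<open>X\<close> the cone) swaps the two vectors with factor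
  \<open>1/\<surd>n\<close>. Hence \<open>e\<^sub>0\<close> evolves into a uniform state in time \<open>\<surd>n arctan \<surd>n\<close>, and a base vertex
  evolves for time \<open>T = (\<pi>/2) \<surd>n\<close> into a state which is found at the conical vertex with
  probability exactly \<open>1/n\<close>. If it is not found there, measuring the base vertices one after
  another costs no time and produces some base vertex, up to a phase, from which the attempt is
  repeated. The number of attempts is geometric with mean \<open>n\<close>, so that the expected time is
  \<open>n T + \<surd>n arctan \<surd>n \<le> \<pi> n\<^bsup>3/2\<^esup>\<close>.
\<close>

section \<open>The matrix exponential\<close>

lemma mult_mat_entry:
  assumes "A \<in> carrier_mat n m" "B \<in> carrier_mat m k" "i < n" "j < k"
  shows "(A * B) $$ (i, j) = (\<Sum>l<m. A $$ (i, l) * B $$ (l, j))"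
  using assms by (auto simp: scalar_prod_def lessThan_atLeast0 intro!: sum.cong)

lemma pow_mat_add:
  fixes M :: "'a :: semiring_1 mat"
  assumes "M \<in> carrier_mat N N"
  shows "M ^\<^sub>m (j + k) = M ^\<^sub>m j * M ^\<^sub>m k"
proof (induction k)
  case (Suc k)
  then show ?case
    using assms by (simp add: assoc_mult_mat[where n\<^sub>1 = N and n\<^sub>2 = N and n\<^sub>3 = N and n\<^sub>4 = N])
qed (use assms in \<open>simp add: right_mult_one_mat'\<close>)

lemma pow_smult_mat_entry:
  fixes M :: "'a :: comm_semiring_1 mat"
  assumes "M \<in> carrier_mat N N" "i < N" "j < N"
  shows "((c \<cdot>\<^sub>m M) ^\<^sub>m k) $$ (i, j) = c ^ k * (M ^\<^sub>m k) $$ (i, j)"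
  using assms(2,3)
proof (induction k arbitrary: i j)
  case (Suc k)
  have "((c \<cdot>\<^sub>m M) ^\<^sub>m Suc k) $$ (i, j) = (\<Sum>l<N. ((c \<cdot>\<^sub>m M) ^\<^sub>m k) $$ (i, l) * (c \<cdot>\<^sub>m M) $$ (l, j))"
    unfolding pow_mat.simps by (rule mult_mat_entry) (use assms(1) Suc.prems in auto)
  also have "\<dots> = c ^ Suc k * (\<Sum>l<N. (M ^\<^sub>m k) $$ (i, l) * M $$ (l, j))"
    unfolding sum_distrib_left by (rule sum.cong) (use assms(1) Suc in \<open>auto simp: ac_simps\<close>)
  also have "(\<Sum>l<N. (M ^\<^sub>m k) $$ (i, l) * M $$ (l, j)) = (M ^\<^sub>m Suc k) $$ (i, j)"
    unfolding pow_mat.simps by (rule mult_mat_entry[symmetric]) (use assms(1) Suc.prems in auto)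
  finally show ?case .
qed (use assms(1) in simp)

lemma norm_pow_mat_entry_le:
  fixes M :: "complex mat"
  assumes M: "M \<in> carrier_mat N N" and c: "\<And>i j. i < N \<Longrightarrow> j < N \<Longrightarrow> norm (M $$ (i, j)) \<le> c"
    and "i < N" "j < N"
  shows "norm ((M ^\<^sub>m k) $$ (i, j)) \<le> (real N * c) ^ k"
  using assms(3,4)
proof (induction k arbitrary: i j)
  case (Suc k)
  have c0: "0 \<le> c"
    using c[OF Suc.prems] norm_ge_zero order_trans by blast
  have "norm ((M ^\<^sub>m Suc k) $$ (i, j)) = norm (\<Sum>l<N. (M ^\<^sub>m k) $$ (i, l) * M $$ (l, j))"
    unfolding pow_mat.simps by (subst mult_mat_entry) (use M Suc.prems in auto)
  also have "\<dots> \<le> (\<Sum>l<N. (real N * c) ^ k * c)"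
    using Suc c0 by (intro sum_norm_le) (auto simp: norm_mult intro!: mult_mono c)
  also have "\<dots> = (real N * c) ^ Suc k"
    by simp
  finally show ?case .
qed (use M in simp)

text \<open>Absolute convergence is what the Cauchy product of two such series requires. A crude
  bound on the entries of powers suffices: the comparison series is that of a scalar
  exponential.\<close>

lemma summable_norm_mat_exp:
  fixes M :: "complex mat"
  assumes M: "M \<in> carrier_mat N N" and "i < N" "j < N"
  shows "summable (\<lambda>k. norm (a ^ k * (M ^\<^sub>m k) $$ (i, j) / fact k))"
proof -
  define c where "c = (\<Sum>i<N. \<Sum>j<N. norm (M $$ (i, j)))"
  have c: "norm (M $$ (i, j)) \<le> c" if "i < N" "j < N" for i j
  proof -
    have "norm (M $$ (i, j)) \<le> (\<Sum>j<N. norm (M $$ (i, j)))"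
      using that by (intro member_le_sum) auto
    also have "\<dots> \<le> c"
      unfolding c_def using that
      by (intro member_le_sum[where f = "\<lambda>i. \<Sum>j<N. norm (M $$ (i, j))"]) (auto intro: sum_nonneg)
    finally show ?thesis .
  qed
  show ?thesis
  proof (rule summable_comparison_test')
    show "summable (\<lambda>k. inverse (fact k) * (norm a * (real N * c)) ^ k)"
      by (rule summable_exp)
    show "norm (norm (a ^ k * (M ^\<^sub>m k) $$ (i, j) / fact k))
      \<le> inverse (fact k) * (norm a * (real N * c)) ^ k" for k
      using mult_left_mono[OF norm_pow_mat_entry_le[OF M c assms(2,3), of k],
          of "norm a ^ k / fact k"]
      by (simp add: norm_mult norm_divide norm_power power_mult_distrib field_simps)
  qed
qed

lemma mat_exp_carrier [simp]: "M \<in> carrier_mat N N \<Longrightarrow> mat_exp M \<in> carrier_mat N N"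
  by (simp add: mat_exp_def)

lemma mat_exp_smult_entry:
  assumes "M \<in> carrier_mat N N" "i < N" "j < N"
  shows "mat_exp (a \<cdot>\<^sub>m M) $$ (i, j) = (\<Sum>k. a ^ k * (M ^\<^sub>m k) $$ (i, j) / fact k)"
  using assms by (simp add: mat_exp_def pow_smult_mat_entry)

lemma binomial_div_fact:
  fixes a b :: complex
  shows "(\<Sum>p\<le>k. a ^ p / fact p * (b ^ (k - p) / fact (k - p))) = (a + b) ^ k / fact k"
proof -
  have "(\<Sum>p\<le>k. a ^ p / fact p * (b ^ (k - p) / fact (k - p))) =
      (\<Sum>p\<le>k. of_nat (k choose p) * a ^ p * b ^ (k - p) / fact k)"
    by (rule sum.cong) (auto simp: binomial_fact field_simps)
  then show ?thesis
    by (simp add: binomial_ring sum_divide_distrib)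
qed

text \<open>Both factors are series in powers of the same matrix, so each coefficient of the Cauchy
  product collapses by the scalar binomial theorem. This yields the inverse of an evolution.\<close>

lemma mat_exp_smult_add:
  assumes M: "M \<in> carrier_mat N N"
  shows "mat_exp (a \<cdot>\<^sub>m M) * mat_exp (b \<cdot>\<^sub>m M) = mat_exp ((a + b) \<cdot>\<^sub>m M)"
proof (rule eq_matI)
  fix i j
  assume "i < dim_row (mat_exp ((a + b) \<cdot>\<^sub>m M))" "j < dim_col (mat_exp ((a + b) \<cdot>\<^sub>m M))"
  then have i: "i < N" and j: "j < N"
    using M by (auto simp: mat_exp_def)
  define f where "f = (\<lambda>c i j k. c ^ k * (M ^\<^sub>m k) $$ (i, j) / fact k)"
  have "(\<lambda>k. \<Sum>l<N. \<Sum>p\<le>k. f a i l p * f b l j (k - p)) sums (\<Sum>l<N. (\<Sum>k. f a i l k) * (\<Sum>k. f b l j k))"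
    using M i j unfolding f_def by (intro sums_sum Cauchy_product_sums summable_norm_mat_exp) auto
  also have "(\<lambda>k. \<Sum>l<N. \<Sum>p\<le>k. f a i l p * f b l j (k - p)) = f (a + b) i j"
  proof
    fix k
    have "(\<Sum>l<N. \<Sum>p\<le>k. f a i l p * f b l j (k - p)) = (\<Sum>p\<le>k. \<Sum>l<N. f a i l p * f b l j (k - p))"
      by (rule sum.swap)
    also have "\<dots> = (\<Sum>p\<le>k. a ^ p / fact p * (b ^ (k - p) / fact (k - p)) * (M ^\<^sub>m k) $$ (i, j))"
    proof (rule sum.cong)
      fix p assume "p \<in> {..k}"
      then have "M ^\<^sub>m k = M ^\<^sub>m p * M ^\<^sub>m (k - p)"
        using pow_mat_add[OF M, of p "k - p"] by simp
      also have "(M ^\<^sub>m p * M ^\<^sub>m (k - p)) $$ (i, j) = (\<Sum>l<N. (M ^\<^sub>m p) $$ (i, l) * (M ^\<^sub>m (k - p)) $$ (l, j))"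
        using M i j by (intro mult_mat_entry) auto
      finally show "(\<Sum>l<N. f a i l p * f b l j (k - p)) =
          a ^ p / fact p * (b ^ (k - p) / fact (k - p)) * (M ^\<^sub>m k) $$ (i, j)"
        by (simp add: f_def sum_distrib_left sum_divide_distrib mult_ac)
    qed simp
    also have "\<dots> = f (a + b) i j k"
      unfolding f_def sum_distrib_right[symmetric] binomial_div_fact by simp
    finally show "(\<Sum>l<N. \<Sum>p\<le>k. f a i l p * f b l j (k - p)) = f (a + b) i j k" .
  qed
  finally have "(\<Sum>l<N. (\<Sum>k. f a i l k) * (\<Sum>k. f b l j k)) = (\<Sum>k. f (a + b) i j k)"
    by (simp add: sums_iff)
  moreover have "(mat_exp (a \<cdot>\<^sub>m M) * mat_exp (b \<cdot>\<^sub>m M)) $$ (i, j)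
      = (\<Sum>l<N. (\<Sum>k. f a i l k) * (\<Sum>k. f b l j k))"
    using M i j
    by (subst mult_mat_entry[where n = N and m = N and k = N])
      (auto simp: mat_exp_smult_entry[OF M] f_def intro!: sum.cong)
  ultimately show "(mat_exp (a \<cdot>\<^sub>m M) * mat_exp (b \<cdot>\<^sub>m M)) $$ (i, j) = mat_exp ((a + b) \<cdot>\<^sub>m M) $$ (i, j)"
    using i j by (simp add: mat_exp_smult_entry[OF M] f_def)
qed (use M in \<open>auto simp: mat_exp_def\<close>)

lemma mat_exp_zero_smult:
  assumes M: "M \<in> carrier_mat N N"
  shows "mat_exp (0 \<cdot>\<^sub>m M) = 1\<^sub>m N"
proof (rule eq_matI)
  fix i j assume "i < dim_row (1\<^sub>m N :: complex mat)" "j < dim_col (1\<^sub>m N :: complex mat)"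
  then show "mat_exp (0 \<cdot>\<^sub>m M) $$ (i, j) = 1\<^sub>m N $$ (i, j)"
    using M powser_zero[of "\<lambda>k. (M ^\<^sub>m k) $$ (i, j) / fact k"]
    by (simp add: mat_exp_smult_entry[OF M] mult.commute)
qed (use M in \<open>auto simp: mat_exp_def\<close>)

section \<open>Hermitian generators and norm preservation\<close>

lemma hermitian_mat_entry:
  assumes "hermitian_mat M" "M \<in> carrier_mat N N" "i < N" "j < N"
  shows "cnj (M $$ (i, j)) = M $$ (j, i)"
proof -
  have "M $$ (j, i) = mat_adjoint M $$ (j, i)"
    using assms(1) by (simp add: hermitian_mat_def)
  also have "\<dots> = cnj (M $$ (i, j))"
    using assms(2-) unfolding mat_adjoint_def by (simp add: mat_of_rows_def)
  finally show ?thesis by simp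
qed

lemma hermitian_matI:
  assumes "M \<in> carrier_mat N N" "\<And>i j. i < N \<Longrightarrow> j < N \<Longrightarrow> cnj (M $$ (i, j)) = M $$ (j, i)"
  shows "hermitian_mat M"
  using assms unfolding hermitian_mat_def mat_adjoint_def
  by (auto intro!: eq_matI simp: mat_of_rows_def)

lemma hermitian_pow_mat_entry:
  assumes "hermitian_mat M" "M \<in> carrier_mat N N" "i < N" "j < N"
  shows "cnj ((M ^\<^sub>m k) $$ (i, j)) = (M ^\<^sub>m k) $$ (j, i)"
  using assms(3,4)
proof (induction k arbitrary: i j)
  case (Suc k)
  have "cnj ((M ^\<^sub>m Suc k) $$ (i, j)) = (\<Sum>l<N. M $$ (j, l) * (M ^\<^sub>m k) $$ (l, i))"
    unfolding pow_mat.simps using assms(1,2) Suc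
    by (subst mult_mat_entry[where n = N and m = N and k = N])
      (auto simp: hermitian_mat_entry mult.commute intro!: sum.cong)
  also have "\<dots> = (M ^\<^sub>m 1 * M ^\<^sub>m k) $$ (j, i)"
    using assms(2) Suc.prems by (subst mult_mat_entry[where n = N and m = N and k = N]) auto
  also have "\<dots> = (M ^\<^sub>m Suc k) $$ (j, i)"
    using pow_mat_add[OF assms(2), of 1 k] by simp
  finally show ?case .
qed (use assms(2) in auto)

lemma hermitian_mat_exp_entry:
  assumes H: "hermitian_mat M" and M: "M \<in> carrier_mat N N" and "i < N" "j < N"
  shows "cnj (mat_exp (a \<cdot>\<^sub>m M) $$ (i, j)) = mat_exp (cnj a \<cdot>\<^sub>m M) $$ (j, i)"
proof -
  have "(\<lambda>k. a ^ k * (M ^\<^sub>m k) $$ (i, j) / fact k) sums (mat_exp (a \<cdot>\<^sub>m M) $$ (i, j))"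
    using summable_norm_cancel[OF summable_norm_mat_exp[OF M assms(3,4)]]
    by (auto simp: mat_exp_smult_entry[OF M assms(3,4)] sums_iff)
  then have "(\<lambda>k. cnj (a ^ k * (M ^\<^sub>m k) $$ (i, j) / fact k)) sums cnj (mat_exp (a \<cdot>\<^sub>m M) $$ (i, j))"
    by (simp only: sums_cnj)
  then show ?thesis
    using assms by (simp add: mat_exp_smult_entry[OF M] hermitian_pow_mat_entry sums_iff)
qed

lemma dim_evolve [simp]:
  "H \<in> carrier_mat N N \<Longrightarrow> dim_vec (evolve H t \<psi>) = N"
  by (simp add: evolve_def mat_exp_def)

lemma evolve_index:
  assumes "H \<in> carrier_mat N N" "dim_vec \<psi> = N" "i < N"
  shows "evolve H t \<psi> $ i = (\<Sum>j<N. mat_exp ((- \<i> * complex_of_real t) \<cdot>\<^sub>m H) $$ (i, j) * \<psi> $ j)"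
  using assms by (auto simp: evolve_def scalar_prod_def mat_exp_def lessThan_atLeast0 intro!: sum.cong)

lemma l2_norm_nonneg: "0 \<le> l2_norm \<psi>"
  by (simp add: l2_norm_def sum_nonneg)

text \<open>For imaginary \<open>a\<close> one has \<open>cnj a = - a\<close>, so \<open>V\<close>,
  the adjoint of \<open>U\<close>, is also its inverse.\<close>

lemma l2_norm_evolve:
  assumes "hermitian_mat H" and H: "H \<in> carrier_mat N N" and d: "dim_vec \<psi> = N"
  shows "l2_norm (evolve H t \<psi>) = l2_norm \<psi>"
proof -
  define a where "a = - \<i> * complex_of_real t"
  define U where "U = mat_exp (a \<cdot>\<^sub>m H)"
  define V where "V = mat_exp (cnj a \<cdot>\<^sub>m H)"
  have UV: "V \<in> carrier_mat N N" "U \<in> carrier_mat N N"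
    using H by (auto simp: U_def V_def)
  have "V * U = 1\<^sub>m N"
    using H by (simp add: U_def V_def a_def mat_exp_smult_add mat_exp_zero_smult)
  then have id: "(\<Sum>i<N. V $$ (j, i) * U $$ (i, l)) = (if j = l then 1 else 0)"
    if "j < N" "l < N" for j l
    using mult_mat_entry[OF UV that] that by simp
  have cU: "cnj (U $$ (i, j)) = V $$ (j, i)" if "i < N" "j < N" for i j
    using hermitian_mat_exp_entry[OF assms(1) H that] by (simp add: U_def V_def)
  have "complex_of_real ((l2_norm (evolve H t \<psi>))\<^sup>2) =
      (\<Sum>i<N. cnj (evolve H t \<psi> $ i) * evolve H t \<psi> $ i)"
    using H by (simp add: l2_norm_sq complex_norm_square mult.commute del: of_real_power)
  \<comment> \<open>The squared norm in coordinates; once the sum over \<open>i\<close> is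
    innermost, it is an entry of \<open>V * U\<close>, the identity.\<close>
  also have "\<dots> = (\<Sum>i<N. \<Sum>j<N. \<Sum>l<N. cnj (\<psi> $ j) * \<psi> $ l * (V $$ (j, i) * U $$ (i, l)))"
  proof (rule sum.cong)
    fix i assume "i \<in> {..<N}"
    then have i: "i < N" by simp
    have U: "evolve H t \<psi> $ i = (\<Sum>l<N. U $$ (i, l) * \<psi> $ l)"
      using evolve_index[OF H d i] by (simp add: U_def a_def)
    have V: "cnj (evolve H t \<psi> $ i) = (\<Sum>j<N. V $$ (j, i) * cnj (\<psi> $ j))"
      unfolding U cnj_sum using i by (intro sum.cong) (simp_all add: cU)
    show "cnj (evolve H t \<psi> $ i) * evolve H t \<psi> $ i =
        (\<Sum>j<N. \<Sum>l<N. cnj (\<psi> $ j) * \<psi> $ l * (V $$ (j, i) * U $$ (i, l)))"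
      unfolding V unfolding U sum_product by (simp add: ac_simps)
  qed simp
  also have "\<dots> = (\<Sum>j<N. \<Sum>l<N. \<Sum>i<N. cnj (\<psi> $ j) * \<psi> $ l * (V $$ (j, i) * U $$ (i, l)))"
    by (subst sum.swap, rule sum.cong[OF refl], rule sum.swap)
  also have "\<dots> = (\<Sum>j<N. \<Sum>l<N. cnj (\<psi> $ j) * \<psi> $ l * (if j = l then 1 else 0))"
    by (simp add: id flip: sum_distrib_left)
  also have "\<dots> = complex_of_real ((l2_norm \<psi>)\<^sup>2)"
    by (simp add: l2_norm_sq complex_norm_square mult.commute d if_distrib cong: if_cong del: of_real_power)
  finally have "(l2_norm (evolve H t \<psi>))\<^sup>2 = (l2_norm \<psi>)\<^sup>2"
    using of_real_eq_iff by blast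
  then show ?thesis
    by (simp add: power2_eq_imp_eq l2_norm_nonneg)
qed


section \<open>Runs of protocols\<close>

text \<open>Makes upper bounds on integrals admissible for fixed-point induction. Monotone
  convergence works along a chain of any cardinality because an spmf has countable support.\<close>

lemma nn_integral_lub_spmf_le:
  assumes chain: "Complete_Partial_Order.chain (ord_spmf (=)) Y" and ne: "Y \<noteq> {}"
    and le: "\<And>p. p \<in> Y \<Longrightarrow> (\<integral>\<^sup>+ x. f x \<partial>measure_spmf p) \<le> c"
  shows "(\<integral>\<^sup>+ x. f x \<partial>measure_spmf (lub_spmf Y)) \<le> c"
proof -
  let ?M = "count_space (set_spmf (lub_spmf Y))"
  have "(\<integral>\<^sup>+ x. f x \<partial>measure_spmf (lub_spmf Y)) = \<integral>\<^sup>+ x. (SUP p\<in>Y. ennreal (spmf p x) * f x) \<partial>?M"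
    by (simp add: nn_integral_measure_spmf' ennreal_spmf_lub_spmf[OF chain ne] SUP_mult_right_ennreal)
  also have "\<dots> = (SUP p\<in>Y. \<integral>\<^sup>+ x. ennreal (spmf p x) * f x \<partial>?M)"
    using ne
  proof (rule nn_integral_monotone_convergence_SUP_countable)
    have "(\<lambda>p x. ennreal (spmf p x) * f x) ` Y = (\<lambda>g x. g x * f x) ` (\<lambda>p x. ennreal (spmf p x)) ` Y"
      by (simp add: image_image)
    also have "Complete_Partial_Order.chain (\<le>) \<dots>"
      using chain_ord_spmf_eqD[OF chain] by (rule chain_imageI) (auto simp: le_fun_def mult_right_mono)
    finally show "Complete_Partial_Order.chain (\<le>) ((\<lambda>p x. ennreal (spmf p x) * f x) ` Y)" .
  qed simp
  also have "\<dots> \<le> c"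
  proof (rule SUP_least)
    fix p assume p: "p \<in> Y"
    have "(\<integral>\<^sup>+ x. ennreal (spmf p x) * f x \<partial>?M) \<le> (\<integral>\<^sup>+ x. ennreal (spmf p x) * f x \<partial>count_space UNIV)"
      by (subst nn_integral_count_space_indicator) (auto intro!: nn_integral_mono split: split_indicator)
    also have "\<dots> \<le> c"
      using le[OF p] by (simp add: nn_integral_measure_spmf)
    finally show "(\<integral>\<^sup>+ x. ennreal (spmf p x) * f x \<partial>?M) \<le> c" .
  qed
  finally show ?thesis .
qed

lemma nn_integral_measure_spmf_bind_pmf:
  "(\<integral>\<^sup>+ x. f x \<partial>measure_spmf (bind_pmf p g)) = (\<integral>\<^sup>+ b. (\<integral>\<^sup>+ x. f x \<partial>measure_spmf (g b)) \<partial>measure_pmf p)"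
  unfolding measure_spmf_bind_pmf o_def
  by (rule nn_integral_bind[where B = "count_space UNIV"])
    (auto simp: space_subprob_algebra intro!: measure_spmf.subprob_space_axioms)

lemma weight_spmf_bind_pmf:
  "weight_spmf (bind_pmf p g) = measure_pmf.expectation p (\<lambda>b. weight_spmf (g b))"
  unfolding weight_spmf_def unfolding measure_spmf_bind_pmf o_def
  by (subst measure_pmf.measure_bind[where N = "count_space UNIV"])
    (auto simp: space_subprob_algebra intro!: measure_spmf.subprob_space_axioms)

lemma run_simps [simp]:
  "run H Stop \<psi> \<tau> = return_spmf (\<psi>, \<tau>)"
  "run H (Evolve t p) \<psi> \<tau> = run H p (evolve H t \<psi>) (\<tau> + t)"
  "run H (Measure a p1 p0) \<psi> \<tau> =
    bind_pmf (measurement a \<psi>) (\<lambda>b. run H (if b then p1 else p0) (post_state a b \<psi>) \<tau>)"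
  by (subst run.simps, simp)+

text \<open>
  \<open>R p \<psi> \<tau> v\<close> relates a configuration \<open>(p, \<psi>, \<tau>)\<close> to a potential \<open>v\<close> that does not increase in
  expectation along the run.
\<close>

lemma nn_integral_run_le_potential:
  fixes R :: "protocol \<Rightarrow> complex vec \<Rightarrow> real \<Rightarrow> real \<Rightarrow> bool" and f :: "complex vec \<times> real \<Rightarrow> ennreal"
  assumes stop: "\<And>\<psi> \<tau> v. R Stop \<psi> \<tau> v \<Longrightarrow> f (\<psi>, \<tau>) \<le> ennreal v"
    and evolve: "\<And>t p \<psi> \<tau> v. R (Evolve t p) \<psi> \<tau> v \<Longrightarrow> R p (evolve H t \<psi>) (\<tau> + t) v"
    and measure: "\<And>a p1 p0 \<psi> \<tau> v. R (Measure a p1 p0) \<psi> \<tau> v \<Longrightarrow>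
      \<exists>w. (\<forall>b. 0 \<le> w b) \<and>
        (\<forall>b\<in>set_pmf (measurement a \<psi>). R (if b then p1 else p0) (post_state a b \<psi>) \<tau> (w b)) \<and>
        (\<Sum>b\<in>UNIV. pmf (measurement a \<psi>) b * w b) \<le> v"
    and R: "R p \<psi> \<tau> v"
  shows "(\<integral>\<^sup>+ x. f x \<partial>measure_spmf (run H p \<psi> \<tau>)) \<le> ennreal v"
proof -
  \<comment> \<open>Quantified over all configurations, since recursive calls change the protocol,
    the state and the elapsed time.\<close>
  define P where "P r \<longleftrightarrow> (\<forall>p \<psi> \<tau> v. R p \<psi> \<tau> v \<longrightarrow>
    (\<integral>\<^sup>+ x. f x \<partial>measure_spmf (r H p \<psi> \<tau>)) \<le> ennreal v)"
    for r :: "complex mat \<Rightarrow> protocol \<Rightarrow> complex vec \<Rightarrow> real \<Rightarrow> (complex vec \<times> real) spmf"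
  have "P run"
  proof (induction rule: run.fixp_induct)
    case 1
    show ?case
    proof (rule ccpo.admissibleI)
      fix Y :: "(((complex mat \<times> protocol) \<times> complex vec) \<times> real \<Rightarrow> (complex vec \<times> real) spmf) set"
      assume Y: "Complete_Partial_Order.chain spmf.le_fun Y" "Y \<noteq> {}"
        and IH: "\<forall>r\<in>Y. P (curry (curry (curry r)))"
      show "P (curry (curry (curry (spmf.lub_fun Y))))"
        unfolding P_def curry_def fun_lub_def
      proof (intro allI impI nn_integral_lub_spmf_le)
        fix p \<psi> \<tau> v q
        assume "R p \<psi> \<tau> v" "q \<in> {y. \<exists>r\<in>Y. y = r (((H, p), \<psi>), \<tau>)}"
        then show "(\<integral>\<^sup>+ x. f x \<partial>measure_spmf q) \<le> ennreal v"
          using IH by (auto simp: P_def)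
      qed (use Y in \<open>auto intro: chain_fun\<close>)
    qed
  next
    case 2
    \<comment> \<open>The bottom element gives no mass to any result, so its integral is 0.\<close>
    show ?case
      by (simp add: P_def nn_integral_measure_spmf)
  next
    case (3 r)
    show ?case
      unfolding P_def
    proof (intro allI impI)
      fix p \<psi> \<tau> v
      assume R: "R p \<psi> \<tau> v"
      show "(\<integral>\<^sup>+ x. f x \<partial>measure_spmf (case p of Stop \<Rightarrow> return_spmf (\<psi>, \<tau>)
          | Evolve t p' \<Rightarrow> r H p' (evolve H t \<psi>) (\<tau> + t)
          | Measure a p1 p0 \<Rightarrow> bind_pmf (measurement a \<psi>)
              (\<lambda>b. r H (if b then p1 else p0) (post_state a b \<psi>) \<tau>))) \<le> ennreal v"
      proof (cases p)
        case Stop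
        then show ?thesis
          using stop R by (simp add: nn_integral_measure_spmf' nn_integral_count_space_finite)
      next
        case (Evolve t p')
        then show ?thesis
          using evolve R 3 unfolding P_def by auto
      next
        case (Measure a p1 p0)
        let ?g = "\<lambda>b. r H (if b then p1 else p0) (post_state a b \<psi>) \<tau>"
        obtain w where w: "\<And>b. 0 \<le> w b"
          "\<And>b. b \<in> set_pmf (measurement a \<psi>) \<Longrightarrow> R (if b then p1 else p0) (post_state a b \<psi>) \<tau> (w b)"
          "(\<Sum>b\<in>UNIV. pmf (measurement a \<psi>) b * w b) \<le> v"
          using measure[OF R[unfolded Measure]] by auto
        have "(\<integral>\<^sup>+ x. f x \<partial>measure_spmf (bind_pmf (measurement a \<psi>) ?g)) =
            (\<integral>\<^sup>+ b. (\<integral>\<^sup>+ x. f x \<partial>measure_spmf (?g b)) \<partial>measure_pmf (measurement a \<psi>))"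
          by (rule nn_integral_measure_spmf_bind_pmf)
        \<comment> \<open>The relation is available only for possible outcomes; the others form a
          null set.\<close>
        also have "\<dots> \<le> (\<integral>\<^sup>+ b. ennreal (w b) \<partial>measure_pmf (measurement a \<psi>))"
          using 3 w(2) unfolding P_def by (intro nn_integral_mono_AE AE_pmfI) blast
        also have "\<dots> = (\<Sum>b\<in>UNIV. ennreal (w b) * pmf (measurement a \<psi>) b)"
          by (rule nn_integral_measure_pmf_support) auto
        also have "\<dots> = ennreal (\<Sum>b\<in>UNIV. pmf (measurement a \<psi>) b * w b)"
          using w(1) by (subst sum_ennreal[symmetric]) (auto simp: ennreal_mult mult.commute)
        also have "\<dots> \<le> ennreal v"
          using w(3) by (rule ennreal_leI)
        finally show ?thesis
          by (simp add: Measure)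
      qed
    qed
  qed
  then show ?thesis
    using R unfolding P_def by blast
qed

section \<open>Single measurements\<close>

lemma l2_norm_smult: "l2_norm (c \<cdot>\<^sub>v \<psi>) = cmod c * l2_norm \<psi>"
  by (simp add: l2_norm_def norm_mult power_mult_distrib real_sqrt_mult flip: sum_distrib_left)

lemma pmf_measurement_True:
  assumes "l2_norm \<psi> = 1" "a < dim_vec \<psi>"
  shows "pmf (measurement a \<psi>) True = (cmod (\<psi> $ a))\<^sup>2"
proof -
  have "(l2_norm (project a True \<psi>))\<^sup>2 = (\<Sum>v<dim_vec \<psi>. if v = a then (cmod (\<psi> $ a))\<^sup>2 else 0)"
    unfolding l2_norm_sq dim_project by (rule sum.cong) (auto simp: project_index)
  with assms show ?thesis
    by (simp add: pmf_measurement)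
qed

lemma pmf_measurement_False:
  "pmf (measurement a \<psi>) False = 1 - pmf (measurement a \<psi>) True"
proof -
  have "(\<Sum>b\<in>UNIV. pmf (measurement a \<psi>) b) = 1"
    by (rule sum_pmf_eq_1) auto
  then show ?thesis
    by (simp add: UNIV_bool)
qed

lemma dim_post_state [simp]: "dim_vec (post_state a b \<psi>) = dim_vec \<psi>"
  by (simp add: post_state_def)

text \<open>Restricted to possible outcomes: for an impossible one the normalisation divides by 0
  and yields the zero vector.\<close>

lemma l2_norm_post_state:
  assumes "l2_norm \<psi> = 1" "b \<in> set_pmf (measurement a \<psi>)"
  shows "l2_norm (post_state a b \<psi>) = 1"
  using assms l2_norm_nonneg[of "project a b \<psi>"]
  by (auto simp: set_pmf_iff pmf_measurement post_state_def l2_norm_smult norm_divide)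

lemma post_state_index_eq_0:
  assumes "v < dim_vec \<psi>" "((v = a) = b) \<longrightarrow> \<psi> $ v = 0"
  shows "post_state a b \<psi> $ v = 0"
  using assms by (auto simp: post_state_def project_index)

text \<open>Fixed-point induction starts from a run of weight 0 and so gives no positive lower
  bounds; stopping probabilities are bounded below by unfolding single steps instead.\<close>

lemma weight_run_Measure_ge:
  assumes "\<And>b. b \<in> set_pmf (measurement a \<psi>) \<Longrightarrow>
    w b \<le> weight_spmf (run H (if b then p1 else p0) (post_state a b \<psi>) \<tau>)"
  shows "(\<Sum>b\<in>UNIV. pmf (measurement a \<psi>) b * w b) \<le> weight_spmf (run H (Measure a p1 p0) \<psi> \<tau>)"
proof -
  have "(\<Sum>b\<in>UNIV. pmf (measurement a \<psi>) b * w b) = measure_pmf.expectation (measurement a \<psi>) w"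
    by (subst integral_measure_pmf[of UNIV]) auto
  also have "\<dots> \<le> weight_spmf (run H (Measure a p1 p0) \<psi> \<tau>)"
    unfolding run_simps weight_spmf_bind_pmf using assms
    by (intro integral_mono_AE AE_pmfI) (auto intro: integrable_measure_pmf_finite)
  finally show ?thesis .
qed


section \<open>The walk on the cone\<close>

text \<open>
  \<open>loop n T s n\<close> is a fresh attempt from a base vertex; \<open>loop n T s 0\<close> tests the conical vertex;
  for \<open>0 < k < n\<close>, \<open>loop n T s k\<close> tests the base vertices from \<open>k\<close> on. Vertex \<open>n\<close> needs no test:
  it is the only one left when all others have been excluded.
\<close>

primcorec loop :: "nat \<Rightarrow> real \<Rightarrow> real \<Rightarrow> nat \<Rightarrow> protocol" where
  "loop n T s k =
    (if k = n then Evolve T (loop n T s 0)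
     else Measure k (if k = 0 then Evolve s Stop else loop n T s n) (loop n T s (Suc k)))"

lemma loop_eq:
  "loop n T s n = Evolve T (loop n T s 0)"
  "n \<noteq> 0 \<Longrightarrow> loop n T s 0 = Measure 0 (Evolve s Stop) (loop n T s 1)"
  "k \<noteq> 0 \<Longrightarrow> k \<noteq> n \<Longrightarrow> loop n T s k = Measure k (loop n T s n) (loop n T s (Suc k))"
  by (subst loop.code; simp)+

lemma loop_neq_Stop: "loop n T s k \<noteq> Stop"
  by (subst loop.code) simp

lemma valid_protocol_loop:
  assumes "0 \<le> T" "0 \<le> s" "k \<le> n"
  shows "valid_protocol (Suc n) (loop n T s k)"
proof -
  \<comment> \<open>The coinduction invariant is a set of protocols closed under subtrees.
    \<open>k = n\<close> never measures, so \<open>Suc k\<close> stays at most \<open>n\<close> in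
    the measuring case.\<close>
  have "valid_protocol (Suc n) p"
    if "p = Stop \<or> p = Evolve s Stop \<or> (\<exists>k\<le>n. p = loop n T s k)" for p
    using that
  proof (coinduction arbitrary: p)
    case valid_protocol
    then consider "p = Stop" | "p = Evolve s Stop" | k where "k \<le> n" "p = loop n T s k"
      by blast
    then show ?case
    proof cases
      case 3
      show ?thesis
      proof (cases "k = n")
        case True
        then show ?thesis
          using 3 assms loop.code[of n T s k] by auto
      next
        case False
        then have "p = Measure k (if k = 0 then Evolve s Stop else loop n T s n) (loop n T s (Suc k))"
          using 3 loop.code[of n T s k] by simp
        moreover have "\<exists>k'\<le>n. loop n T s (Suc k) = loop n T s k'"
          using False 3 by (intro exI[of _ "Suc k"]) auto
        ultimately show ?thesis
          using 3 by auto
      qed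
    qed (use assms in auto)
  qed
  then show ?thesis
    using assms by blast
qed

text \<open>A basis vector up to a phase, which is all that a successful test guarantees. The phase
  is harmless, as only moduli of amplitudes matter later.\<close>

definition concentrated :: "nat \<Rightarrow> complex vec \<Rightarrow> bool" where
  "concentrated w \<psi> \<longleftrightarrow> w < dim_vec \<psi> \<and> l2_norm \<psi> = 1 \<and> (\<forall>v<dim_vec \<psi>. v \<noteq> w \<longrightarrow> \<psi> $ v = 0)"

lemma concentrated_unit_vec: "w < N \<Longrightarrow> concentrated w (unit_vec N w)"
  by (auto simp: concentrated_def l2_norm_def if_distrib[where f = "\<lambda>x. (cmod x)\<^sup>2"] cong: if_cong)

lemma concentrated_norm:
  assumes "concentrated w \<psi>"
  shows "cmod (\<psi> $ w) = 1"
proof -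
  have "1 = (\<Sum>v<dim_vec \<psi>. (cmod (\<psi> $ v))\<^sup>2)"
    using assms l2_norm_sq[of \<psi>] by (simp add: concentrated_def)
  also have "\<dots> = (\<Sum>v<dim_vec \<psi>. if v = w then (cmod (\<psi> $ w))\<^sup>2 else 0)"
    using assms by (intro sum.cong) (auto simp: concentrated_def)
  also have "\<dots> = (cmod (\<psi> $ w))\<^sup>2"
    using assms by (simp add: concentrated_def)
  finally show ?thesis
    by (simp add: power2_eq_1_iff) (smt (verit) norm_ge_zero)
qed

text \<open>The evolved state is column \<open>w\<close> of the exponential times a phase, and the
  phase has modulus 1.\<close>

lemma norm_evolve_concentrated:
  assumes "concentrated w \<psi>" "H \<in> carrier_mat N N" "dim_vec \<psi> = N" "i < N"
  shows "cmod (evolve H t \<psi> $ i) = cmod (mat_exp ((- \<i> * complex_of_real t) \<cdot>\<^sub>m H) $$ (i, w))"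
proof -
  have "evolve H t \<psi> $ i =
      (\<Sum>j<N. if j = w then mat_exp ((- \<i> * complex_of_real t) \<cdot>\<^sub>m H) $$ (i, w) * \<psi> $ w else 0)"
    unfolding evolve_index[OF assms(2-4)]
    using assms by (intro sum.cong) (auto simp: concentrated_def)
  then show ?thesis
    using assms concentrated_norm[OF assms(1)] by (simp add: concentrated_def norm_mult)
qed

lemma concentrated_post_state_True:
  assumes "l2_norm \<psi> = 1" "a < dim_vec \<psi>" "True \<in> set_pmf (measurement a \<psi>)"
  shows "concentrated a (post_state a True \<psi>)"
  using assms by (auto simp: concentrated_def l2_norm_post_state intro!: post_state_index_eq_0)

section \<open>Amplitudes from and to the conical vertex\<close>

locale walk_on_cone =
  fixes n :: nat and A :: "complex mat"
  assumes n: "1 \<le> n" and A: "A \<in> carrier_mat n n" and hermitian: "hermitian_mat A"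
    and eigenvector: "eigenvector A (ones_vec n) 0"
begin

definition H :: "complex mat" where
  "H = complex_of_real (1 / real n) \<cdot>\<^sub>m cone_mat A"

lemma H_carrier: "H \<in> carrier_mat (Suc n) (Suc n)"
  using A by (auto simp: H_def cone_mat_def Let_def)

lemma H_entry:
  "H $$ (0, 0) = 0"
  "j < n \<Longrightarrow> H $$ (0, Suc j) = 1 / of_nat n"
  "j < n \<Longrightarrow> H $$ (Suc j, 0) = 1 / of_nat n"
  "i < n \<Longrightarrow> j < n \<Longrightarrow> H $$ (Suc i, Suc j) = A $$ (i, j) / of_nat n"
  using A by (auto simp: H_def cone_mat_def Let_def)

lemma hermitian_H: "hermitian_mat H"
proof (rule hermitian_matI[OF H_carrier])
  fix i j assume "i < Suc n" "j < Suc n"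
  then show "cnj (H $$ (i, j)) = H $$ (j, i)"
    by (cases i; cases j) (auto simp: H_entry hermitian_mat_entry[OF hermitian A])
qed

text \<open>The eigenvector equation says that row sums vanish; Hermitian symmetry transfers this to
  columns, as needed when a row vector is multiplied by \<open>H\<close> from the right.\<close>

lemma sum_column_eq_0:
  assumes j: "j < n"
  shows "(\<Sum>l<n. A $$ (l, j)) = 0"
proof -
  have "(\<Sum>l<n. A $$ (j, l)) = (A *\<^sub>v ones_vec n) $ j"
    using A j by (auto simp: scalar_prod_def ones_vec_def lessThan_atLeast0 intro!: sum.cong)
  also have "\<dots> = 0"
    using eigenvector j by (auto simp: eigenvector_def ones_vec_def simp del: index_mult_mat_vec)
  finally have "cnj (\<Sum>l<n. A $$ (j, l)) = 0"
    by simp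
  then show ?thesis
    using j by (simp add: hermitian_mat_entry[OF hermitian A])
qed

text \<open>Row 0 alternates between the conical vertex and a constant row on the base. The step to
  the base contributes \<open>1 / n = r * r\<close>; the step back sums \<open>n\<close> entries
  \<open>1 / n\<close> and contributes 1. A constant row on the base never leaks into the base,
  because the column sums of \<open>A\<close> vanish.\<close>

lemma pow_H_row_0:
  fixes r :: complex
  defines "r \<equiv> complex_of_real (1 / sqrt n)"
  assumes "j < Suc n"
  shows "(H ^\<^sub>m k) $$ (0, j) =
    (if even k then (if j = 0 then r ^ k else 0) else (if j = 0 then 0 else r ^ Suc k))"
  using assms(2)
proof (induction k arbitrary: j)
  case (Suc k)
  have r2: "r * r = 1 / of_nat n"
    using n by (simp add: r_def flip: of_real_mult)
  have n0: "of_nat n \<noteq> (0 :: complex)"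
    using n by simp
  have "(H ^\<^sub>m Suc k) $$ (0, j) = (\<Sum>l<Suc n. (H ^\<^sub>m k) $$ (0, l) * H $$ (l, j))"
    unfolding pow_mat.simps using H_carrier Suc.prems by (intro mult_mat_entry) auto
  also have "\<dots> = (\<Sum>l<Suc n. (if even k then (if l = 0 then r ^ k else 0)
      else (if l = 0 then 0 else r ^ Suc k)) * H $$ (l, j))"
    using Suc.IH by (intro sum.cong) auto
  also have "\<dots> = (if even k then r ^ k * H $$ (0, j) else r ^ Suc k * (\<Sum>l<n. H $$ (Suc l, j)))"
    by (simp add: sum.lessThan_Suc_shift sum_distrib_left del: sum.lessThan_Suc)
  also have "\<dots> = (if even (Suc k) then (if j = 0 then r ^ Suc k else 0)
      else (if j = 0 then 0 else r ^ Suc (Suc k)))"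
  proof (cases j)
    case 0
    then show ?thesis
      using n0 by (simp add: H_entry)
  next
    case (Suc j')
    then have "(\<Sum>l<n. H $$ (Suc l, j)) = (\<Sum>l<n. A $$ (l, j')) / of_nat n" "H $$ (0, j) = r * r"
      using \<open>j < Suc n\<close> by (simp_all add: H_entry sum_divide_distrib r2)
    then show ?thesis
      using Suc \<open>j < Suc n\<close> by (simp add: sum_column_eq_0 ac_simps)
  qed
  finally show ?case .
qed (use H_carrier in auto)

text \<open>The even and odd powers of \<open>pow_H_row_0\<close> form the series of
  \<open>cosh\<close> and \<open>sinh\<close> at an imaginary argument.\<close>

lemma mat_exp_H_row_0:
  assumes "j < Suc n"
  shows "mat_exp ((- \<i> * complex_of_real t) \<cdot>\<^sub>m H) $$ (0, j) =
    (if j = 0 then complex_of_real (cos (t / sqrt n))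
     else - \<i> * complex_of_real (sin (t / sqrt n) / sqrt n))"
proof -
  define r where "r = complex_of_real (1 / sqrt n)"
  define a where "a = - \<i> * complex_of_real t"
  have ar: "a * r = - (\<i> * complex_of_real (t / sqrt n))"
    by (simp add: a_def r_def)
  have e: "mat_exp (a \<cdot>\<^sub>m H) $$ (0, j) = (\<Sum>k. a ^ k * (H ^\<^sub>m k) $$ (0, j) / fact k)"
    using assms by (intro mat_exp_smult_entry[OF H_carrier]) auto
  show ?thesis
  proof (cases "j = 0")
    case True
    have "(\<lambda>k. a ^ k * (H ^\<^sub>m k) $$ (0, j) / fact k) =
        (\<lambda>k. if even k then (a * r) ^ k /\<^sub>R fact k else 0)"
      using True pow_H_row_0[of 0] n
      by (auto simp: r_def power_mult_distrib scaleR_conv_of_real divide_inverse mult_ac)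
    then have "mat_exp (a \<cdot>\<^sub>m H) $$ (0, j) = cosh (a * r)"
      unfolding e using cosh_converges[of "a * r"] by (simp add: sums_iff)
    also have "\<dots> = complex_of_real (cos (t / sqrt n))"
      by (simp add: ar cosh_conv_cos flip: of_real_divide cos_of_real)
    finally show ?thesis
      using True by (simp add: a_def)
  next
    case False
    \<comment> \<open>The constant row on the base is not normalised, which leaves one factor
      \<open>r\<close> outside the odd series.\<close>
    have "(\<lambda>k. a ^ k * (H ^\<^sub>m k) $$ (0, j) / fact k) =
        (\<lambda>k. r * (if even k then 0 else (a * r) ^ k /\<^sub>R fact k))"
      using False pow_H_row_0[OF assms] n
      by (auto simp: r_def power_mult_distrib scaleR_conv_of_real divide_inverse mult_ac)
    then have "mat_exp (a \<cdot>\<^sub>m H) $$ (0, j) = r * sinh (a * r)"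
      unfolding e using sums_mult[OF sinh_converges[of "a * r"], of r] by (simp add: sums_iff)
    also have "sinh (a * r) = - \<i> * complex_of_real (sin (t / sqrt n))"
      unfolding ar by (simp add: sinh_conv_sin flip: of_real_divide sin_of_real)
    finally show ?thesis
      using False by (simp add: a_def r_def)
  qed
qed

text \<open>A start at the conical vertex needs column 0, whereas row 0 has been computed; for
  Hermitian \<open>H\<close> they are conjugate at opposite times.\<close>

lemma norm_mat_exp_H_column_0:
  assumes "j < Suc n"
  shows "cmod (mat_exp ((- \<i> * complex_of_real t) \<cdot>\<^sub>m H) $$ (j, 0)) =
    cmod (mat_exp ((- \<i> * complex_of_real (- t)) \<cdot>\<^sub>m H) $$ (0, j))"
  using hermitian_mat_exp_entry[OF hermitian_H H_carrier, of j 0 "- \<i> * complex_of_real t"] assms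
  by (metis complex_mod_cnj complex_cnj_complex_of_real complex_cnj_i complex_cnj_minus
      complex_cnj_mult minus_mult_commute minus_minus of_real_minus zero_less_Suc)

text \<open>Here \<open>sin (T / sqrt n) = 1\<close>, so the amplitude passed from a base vertex to
  the conical vertex has its largest modulus, \<open>1 / sqrt n\<close>.\<close>

definition T :: real where "T = pi / 2 * sqrt n"

text \<open>The solution of \<open>tan (s / sqrt n) = sqrt n\<close>: starting at the conical
  vertex, the squared cosine left there equals the squared sine divided among \<open>n\<close> base
  vertices.\<close>

definition s :: real where "s = sqrt n * arctan (sqrt n)"

lemma T_nonneg: "0 \<le> T" and s_nonneg: "0 \<le> s"
  by (auto simp: T_def s_def)

text \<open>The probability is the same for every base vertex, so an attempt may start from
  whichever one the tests produce.\<close>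

lemma evolve_T:
  assumes "concentrated w \<psi>" "dim_vec \<psi> = Suc n" "0 < w"
  shows "(cmod (evolve H T \<psi> $ 0))\<^sup>2 = 1 / n"
  using assms n norm_evolve_concentrated[OF assms(1) H_carrier assms(2), of 0 T]
    mat_exp_H_row_0[of w T]
  by (simp add: concentrated_def T_def norm_mult norm_divide power_divide)

lemma evolve_s:
  assumes "concentrated 0 \<psi>" and d: "dim_vec \<psi> = Suc n"
  shows "uniform_state (evolve H s \<psi>)"
  unfolding uniform_state_def dim_evolve[OF H_carrier]
proof (intro allI impI)
  fix v assume v: "v < Suc n"
  have "s / sqrt n = arctan (sqrt n)"
    using n by (simp add: s_def)
  moreover have "(cos (arctan (sqrt n)))\<^sup>2 = 1 / (1 + n)" "(sin (arctan (sqrt n)))\<^sup>2 = n / (1 + n)"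
    by (simp_all add: cos_arctan sin_arctan power_divide)
  \<comment> \<open>Column 0 at time \<open>s\<close> has the moduli of row 0 at time
    \<open>- s\<close>; the sign of the sine disappears in them.\<close>
  ultimately show "(cmod (evolve H s \<psi> $ v))\<^sup>2 = 1 / real (Suc n)"
    using n v norm_evolve_concentrated[OF assms(1) H_carrier d v]
      norm_mat_exp_H_column_0[OF v, of s] mat_exp_H_row_0[OF v, of "- s"]
    by (auto simp: norm_mult norm_divide power_divide)
qed

section \<open>States within an attempt\<close>

text \<open>Invariant of the state in which \<open>loop n T s k\<close> is entered.\<close>

definition loop_state :: "nat \<Rightarrow> complex vec \<Rightarrow> bool" where
  "loop_state k \<psi> \<longleftrightarrow> dim_vec \<psi> = Suc n \<and> l2_norm \<psi> = 1 \<and>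
    (if k = n then \<exists>w>0. concentrated w \<psi>
     else if k = 0 then (cmod (\<psi> $ 0))\<^sup>2 = 1 / n
     else \<forall>v<k. \<psi> $ v = 0)"

lemma loop_state_evolve:
  assumes "loop_state n \<psi>"
  shows "loop_state 0 (evolve H T \<psi>)"
  using assms n evolve_T
  by (auto simp: loop_state_def H_carrier dim_evolve[OF H_carrier] l2_norm_evolve[OF hermitian_H H_carrier])

lemma loop_state_post_False:
  assumes st: "loop_state k \<psi>" and k: "k < n" and b: "False \<in> set_pmf (measurement k \<psi>)"
  shows "loop_state (Suc k) (post_state k False \<psi>)"
proof -
  have 1: "dim_vec (post_state k False \<psi>) = Suc n" "l2_norm (post_state k False \<psi>) = 1"
    using st b by (auto simp: loop_state_def l2_norm_post_state)
  have 2: "post_state k False \<psi> $ v = 0" if "v < Suc k" for v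
    using st k that by (intro post_state_index_eq_0) (auto simp: loop_state_def split: if_splits)
  show ?thesis
  proof (cases "Suc k = n")
    case True
    \<comment> \<open>Vertices below \<open>n\<close> carry no amplitude, so the unit vector sits on
      vertex \<open>n\<close>. For \<open>n = 1\<close> this happens right after the test of the
      conical vertex.\<close>
    then have "concentrated n (post_state k False \<psi>)"
      using 1 2 by (auto simp: concentrated_def)
    then show ?thesis
      using 1 n True by (auto simp: loop_state_def)
  qed (use 1 2 in \<open>auto simp: loop_state_def\<close>)
qed

lemma loop_state_post_True:
  assumes "loop_state k \<psi>" "0 < k" "k < n" "True \<in> set_pmf (measurement k \<psi>)"
  shows "loop_state n (post_state k True \<psi>)"
  using assms concentrated_post_state_True[of \<psi> k]
  by (auto simp: loop_state_def l2_norm_post_state)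

lemma pmf_measurement_loop_state_0:
  assumes "loop_state 0 \<psi>"
  shows "pmf (measurement 0 \<psi>) True = 1 / n" "pmf (measurement 0 \<psi>) False = 1 - 1 / n"
  using assms n by (auto simp: loop_state_def pmf_measurement_True pmf_measurement_False)

section \<open>Expected time and uniformity of the final state\<close>

text \<open>
  An attempt takes time \<open>T\<close> and succeeds with probability \<open>1 / n\<close>, so that \<open>n\<close> attempts are expected
  before the final evolution of length \<open>s\<close>; at \<open>k = 0\<close> the evolution of the current attempt is over.
\<close>

definition potential :: "protocol \<Rightarrow> complex vec \<Rightarrow> real \<Rightarrow> real \<Rightarrow> bool" where
  "potential p \<psi> \<tau> v \<longleftrightarrow> 0 \<le> \<tau> \<and>
    ((\<exists>k\<le>n. p = loop n T s k \<and> loop_state k \<psi> \<and> v = \<tau> + n * T + s - (if k = 0 then T else 0)) \<or>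
     p = Evolve s Stop \<and> concentrated 0 \<psi> \<and> dim_vec \<psi> = Suc n \<and> v = \<tau> + s \<or>
     p = Stop \<and> uniform_state \<psi> \<and> v = \<tau>)"

lemma potential_run:
  fixes f :: "complex vec \<times> real \<Rightarrow> ennreal"
    \<comment> \<open>A finite integral of \<open>f\<close> also forces every final state to be uniform.\<close>
  defines "f \<equiv> \<lambda>x. if uniform_state (fst x) then ennreal (snd x) else \<infinity>"
  assumes "potential p \<psi> \<tau> v"
  shows "(\<integral>\<^sup>+ x. f x \<partial>measure_spmf (run H p \<psi> \<tau>)) \<le> ennreal v"
proof (rule nn_integral_run_le_potential[where R = potential])
  show "potential p \<psi> \<tau> v"
    by (rule assms(2))
next
  fix \<psi> \<tau> v
  assume "potential Stop \<psi> \<tau> v"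
  then have "uniform_state \<psi> \<and> v = \<tau>"
    by (auto simp: potential_def loop_neq_Stop[symmetric])
  then show "f (\<psi>, \<tau>) \<le> ennreal v"
    by (simp add: f_def)
next
  fix t p \<psi> \<tau> v
  assume "potential (Evolve t p) \<psi> \<tau> v"
  then consider k where "0 \<le> \<tau>" "k \<le> n" "Evolve t p = loop n T s k" "loop_state k \<psi>"
      "v = \<tau> + n * T + s - (if k = 0 then T else 0)"
    | "0 \<le> \<tau>" "t = s" "p = Stop" "concentrated 0 \<psi>" "dim_vec \<psi> = Suc n" "v = \<tau> + s"
    by (auto simp: potential_def)
  then show "potential p (evolve H t \<psi>) (\<tau> + t) v"
  proof cases
    case 1
    then have "k = n" "t = T" "p = loop n T s 0"
      using loop.code[of n T s k] by (auto split: if_splits)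
    \<comment> \<open>The elapsed time grows by \<open>T\<close> and the remaining cost drops by
      \<open>T\<close>, so \<open>v\<close> is unchanged.\<close>
    with 1 n show ?thesis
      using loop_state_evolve T_nonneg by (auto simp: potential_def)
  next
    case 2
    then show ?thesis
      using evolve_s s_nonneg by (simp add: potential_def)
  qed
next
  fix a p1 p0 \<psi> \<tau> v
  assume "potential (Measure a p1 p0) \<psi> \<tau> v"
  then obtain k where k: "0 \<le> \<tau>" "k \<le> n" "Measure a p1 p0 = loop n T s k" "loop_state k \<psi>"
      "v = \<tau> + n * T + s - (if k = 0 then T else 0)"
    by (auto simp: potential_def)
  have "k \<noteq> n" "a = k" and p1: "p1 = (if k = 0 then Evolve s Stop else loop n T s n)"
    and p0: "p0 = loop n T s (Suc k)"
    using k(3) loop.code[of n T s k] by (auto split: if_splits)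
  have kn: "k < n"
    using k \<open>k \<noteq> n\<close> by simp
  \<comment> \<open>Only success at the conical vertex leaves just \<open>s\<close> to pay. All
    other outcomes keep the cost of \<open>n\<close> further attempts, since tests take no
    time.\<close>
  define w where "w b = (if b \<and> k = 0 then \<tau> + s else \<tau> + n * T + s)" for b
  show "\<exists>w. (\<forall>b. 0 \<le> w b) \<and>
      (\<forall>b\<in>set_pmf (measurement a \<psi>). potential (if b then p1 else p0) (post_state a b \<psi>) \<tau> (w b)) \<and>
      (\<Sum>b\<in>UNIV. pmf (measurement a \<psi>) b * w b) \<le> v"
  proof (intro exI[of _ w] conjI ballI allI)
    show "0 \<le> w b" for b
      using k T_nonneg s_nonneg by (auto simp: w_def)
  next
    fix b assume b: "b \<in> set_pmf (measurement a \<psi>)"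
    have "potential p0 (post_state k False \<psi>) \<tau> (w False)" if "\<not> b"
      using loop_state_post_False[OF k(4) kn] that b \<open>a = k\<close> k(1) kn
      unfolding potential_def p0 w_def by (auto intro!: exI[of _ "Suc k"])
    moreover have "potential p1 (post_state k True \<psi>) \<tau> (w True)" if b
    proof (cases "k = 0")
      case True
      then show ?thesis
        using concentrated_post_state_True[of \<psi> 0] that b k \<open>a = k\<close>
        unfolding potential_def p1 w_def by (auto simp: loop_state_def)
    next
      case False
      then show ?thesis
        using loop_state_post_True[OF k(4) _ kn] that b k(1) \<open>a = k\<close> n
        unfolding potential_def p1 w_def by (auto intro!: exI[of _ n])
    qed
    ultimately show "potential (if b then p1 else p0) (post_state a b \<psi>) \<tau> (w b)"
      using \<open>a = k\<close> by (cases b) auto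
  next
    show "(\<Sum>b\<in>UNIV. pmf (measurement a \<psi>) b * w b) \<le> v"
    proof (cases "k = 0")
      case True
      \<comment> \<open>Equality holds: failure has probability \<open>1 - 1 / n\<close> and costs
        \<open>n * T\<close> more than success, which averages to \<open>n * T - T\<close>.\<close>
      then show ?thesis
        using pmf_measurement_loop_state_0[of \<psi>] k(4,5) n \<open>a = k\<close>
        by (simp add: UNIV_bool w_def) (simp add: field_simps)
    next
      case False
      then have "(\<Sum>b\<in>UNIV. pmf (measurement a \<psi>) b * w b) = (\<Sum>b\<in>UNIV. pmf (measurement a \<psi>) b) * v"
        by (simp add: w_def k UNIV_bool distrib_right)
      also have "(\<Sum>b\<in>UNIV. pmf (measurement a \<psi>) b) = 1"
        by (rule sum_pmf_eq_1) auto
      finally show ?thesis by simp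
    qed
  qed
qed

section \<open>Almost sure termination\<close>

text \<open>
  The least stopping probability \<open>m\<close> of an attempt satisfies \<open>m \<ge> 1 / n + (1 - 1 / n) m\<close>, hence
  \<open>m \<ge> 1\<close>.
\<close>

lemma lossless_run_loop:
  assumes "loop_state n \<psi>"
  shows "lossless_spmf (run H (loop n T s n) \<psi> \<tau>)"
proof -
  define W where "W = (\<lambda>k (\<psi>, \<tau>). weight_spmf (run H (loop n T s k) \<psi> \<tau>))"
  \<comment> \<open>The infimum ranges over all fresh starts and elapsed times, because a restart
    changes the base vertex, the phase and the time.\<close>
  define m where "m = (INF x\<in>{\<psi>. loop_state n \<psi>} \<times> UNIV. W n x)"
  have bdd: "bdd_below (W n ` X)" for X
    by (rule bdd_belowI[of _ 0]) (auto simp: W_def weight_spmf_nonneg)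
  \<comment> \<open>Downward induction from \<open>k = n\<close>: a test of a base vertex restarts
    or moves on to \<open>Suc k\<close>, and both continuations stop with probability at least
    \<open>m\<close>. The case \<open>k = 0\<close> is separate, as success there ends the
    loop.\<close>
  have step: "m \<le> W k (\<psi>, \<tau>)" if "k \<le> n" "0 < k" "loop_state k \<psi>" for k \<psi> \<tau>
    using that
  proof (induction k arbitrary: \<psi> rule: inc_induct)
    case base
    then show ?case
      unfolding m_def by (intro cINF_lower bdd) auto
  next
    case (step k)
    have "m = (\<Sum>b\<in>UNIV. pmf (measurement k \<psi>) b * m)"
      using sum_pmf_eq_1[of UNIV "measurement k \<psi>"] by (simp flip: sum_distrib_right)
    also have "\<dots> \<le> weight_spmf (run H (Measure k (loop n T s n) (loop n T s (Suc k))) \<psi> \<tau>)"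
    proof (rule weight_run_Measure_ge)
      fix b assume b: "b \<in> set_pmf (measurement k \<psi>)"
      show "m \<le> weight_spmf (run H (if b then loop n T s n else loop n T s (Suc k)) (post_state k b \<psi>) \<tau>)"
      proof (cases b)
        case True
        then have "loop_state n (post_state k True \<psi>)"
          using loop_state_post_True[of k \<psi>] step b by auto
        then have "m \<le> W n (post_state k True \<psi>, \<tau>)"
          unfolding m_def by (intro cINF_lower bdd) auto
        with True show ?thesis
          by (simp add: W_def)
      next
        case False
        then have "loop_state (Suc k) (post_state k False \<psi>)"
          using loop_state_post_False[of k \<psi>] step b by auto
        then show ?thesis
          using step.IH[of "post_state k False \<psi>"] False by (simp add: W_def)
      qed
    qed
    also have "\<dots> = W k (\<psi>, \<tau>)"
      using step by (simp add: W_def loop_eq(3) del: run_simps)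
    finally show ?case .
  qed
  have "1 / n + (1 - 1 / n) * m \<le> W n (\<psi>, \<tau>)" if st: "loop_state n \<psi>" for \<psi> \<tau>
  proof -
    define \<phi> where "\<phi> = evolve H T \<psi>"
    have \<phi>: "loop_state 0 \<phi>"
      using st by (simp add: \<phi>_def loop_state_evolve)
    have "1 / n + (1 - 1 / n) * m = (\<Sum>b\<in>UNIV. pmf (measurement 0 \<phi>) b * (if b then 1 else m))"
      using pmf_measurement_loop_state_0[OF \<phi>] by (simp add: UNIV_bool)
    also have "\<dots> \<le> weight_spmf (run H (Measure 0 (Evolve s Stop) (loop n T s 1)) \<phi> (\<tau> + T))"
    proof (rule weight_run_Measure_ge)
      fix b assume b: "b \<in> set_pmf (measurement 0 \<phi>)"
      show "(if b then 1 else m) \<le>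
          weight_spmf (run H (if b then Evolve s Stop else loop n T s 1) (post_state 0 b \<phi>) (\<tau> + T))"
      proof (cases b)
        case False
        then show ?thesis
          using step[of 1 "post_state 0 False \<phi>" "\<tau> + T"] loop_state_post_False[OF \<phi>] b n
          by (simp add: W_def)
      qed simp
    qed
    also have "\<dots> = W n (\<psi>, \<tau>)"
      using n by (simp add: W_def \<phi>_def loop_eq(1,2))
    finally show ?thesis .
  qed
  \<comment> \<open>The bound holds for every fresh start, hence for the infimum;
    \<open>assms\<close> makes the index set nonempty.\<close>
  then have "1 / n + (1 - 1 / n) * m \<le> m"
    unfolding m_def[symmetric] using assms by (subst (2) m_def, intro cINF_greatest) auto
  then have "1 \<le> m"
    using n by (simp add: field_simps)
  also have "m \<le> W n (\<psi>, \<tau>)"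
    using step[of n \<psi>] assms n by simp
  finally show ?thesis
    using weight_spmf_le_1[of "run H (loop n T s n) \<psi> \<tau>"] by (simp add: W_def lossless_spmf_def)
qed

text \<open>A finite integral leaves no mass where the integrand is infinite, and almost everywhere
  for an spmf means everywhere on its support. The integrand also dominates the time.\<close>

lemma potential_imp_mixing:
  assumes "potential p \<psi> \<tau> v"
  shows "\<forall>(\<phi>, t)\<in>set_spmf (run H p \<psi> \<tau>). uniform_state \<phi>"
    and "expected_time (run H p \<psi> \<tau>) \<le> ennreal v"
proof -
  let ?f = "\<lambda>x :: complex vec \<times> real. if uniform_state (fst x) then ennreal (snd x) else \<infinity>"
  have le: "(\<integral>\<^sup>+ x. ?f x \<partial>measure_spmf (run H p \<psi> \<tau>)) \<le> ennreal v"
    using assms by (rule potential_run)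
  then have "(\<integral>\<^sup>+ x. ?f x \<partial>measure_spmf (run H p \<psi> \<tau>)) \<noteq> \<infinity>"
    by (metis ennreal_less_top infinity_ennreal_def leD)
  then have "AE x in measure_spmf (run H p \<psi> \<tau>). ?f x \<noteq> \<infinity>"
    by (intro nn_integral_noteq_infinite) auto
  then show "\<forall>(\<phi>, t)\<in>set_spmf (run H p \<psi> \<tau>). uniform_state \<phi>"
    by (auto simp: AE_measure_spmf_iff split: if_splits)
  have "expected_time (run H p \<psi> \<tau>) \<le> (\<integral>\<^sup>+ x. ?f x \<partial>measure_spmf (run H p \<psi> \<tau>))"
    unfolding expected_time_def by (intro nn_integral_mono) auto
  with le show "expected_time (run H p \<psi> \<tau>) \<le> ennreal v"
    by simp
qed

section \<open>The bound and the protocols for all start vertices\<close>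

lemma time_bound: "n * T + s \<le> pi * real n powr (3 / 2)"
proof -
  have "real n powr (3 / 2) = real n powr (1 + 1 / 2)"
    by simp
  also have "\<dots> = n * sqrt n"
    using n by (subst powr_add) (simp add: powr_half_sqrt)
  finally have *: "real n powr (3 / 2) = n * sqrt n" .
  have "s \<le> sqrt n * (pi / 2)"
    unfolding s_def using arctan_ubound[of "sqrt n"] by (intro mult_left_mono) auto
  \<comment> \<open>By \<open>1 \<le> n\<close>, the final evolution costs at most half of the
    bound; the attempts account for the other half.\<close>
  also have "\<dots> \<le> n * (sqrt n * (pi / 2))"
    using n mult_right_mono[of 1 "real n" "sqrt n * (pi / 2)"] by simp
  also have "\<dots> = pi * (n * sqrt n) / 2"
    by simp
  finally have "s \<le> pi * (n * sqrt n) / 2" .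
  moreover have "n * T = pi * (n * sqrt n) / 2"
    by (simp add: T_def)
  ultimately show ?thesis
    unfolding * by linarith
qed

lemma las_vegas_uniform_mixing_H: "las_vegas_uniform_mixing H (pi * real n powr (3 / 2))"
  unfolding las_vegas_uniform_mixing_def Let_def
proof (intro allI impI)
  fix u assume "u < dim_row H"
  then have u: "u < Suc n" and dim: "dim_row H = Suc n"
    using H_carrier by auto
  let ?\<psi> = "unit_vec (Suc n) u :: complex vec"
  have conc: "concentrated u ?\<psi>"
    using u by (rule concentrated_unit_vec)
  obtain p v where p: "valid_protocol (Suc n) p" "lossless_spmf (run H p ?\<psi> 0)"
    "potential p ?\<psi> 0 v" "v \<le> n * T + s"
  \<comment> \<open>From the conical vertex a single evolution of length \<open>s\<close> suffices;
    from a base vertex the loop is entered at \<open>n\<close>, a fresh attempt.\<close>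
  proof (cases "u = 0")
    case True
    have "potential (Evolve s Stop) ?\<psi> 0 s"
      using conc True by (simp add: potential_def)
    then show ?thesis
      using that[of "Evolve s Stop" s] s_nonneg T_nonneg
      by (simp add: valid_protocol.intros)
  next
    case False
    then have "loop_state n ?\<psi>"
      using conc by (auto simp: loop_state_def concentrated_def)
    moreover from this have "potential (loop n T s n) ?\<psi> 0 (n * T + s)"
      using n unfolding potential_def by (intro conjI disjI1 exI[of _ n]) auto
    ultimately show ?thesis
      using that valid_protocol_loop[OF T_nonneg s_nonneg, of n] lossless_run_loop by blast
  qed
  have "expected_time (run H p ?\<psi> 0) \<le> ennreal v"
    using p(3) by (rule potential_imp_mixing)
  also have "\<dots> \<le> ennreal (pi * real n powr (3 / 2))"
    using p(4) time_bound by (intro ennreal_leI) simp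
  finally show "\<exists>p. valid_protocol (dim_row H) p \<and> lossless_spmf (run H p (unit_vec (dim_row H) u) 0) \<and>
      (\<forall>(\<psi>, \<tau>)\<in>set_spmf (run H p (unit_vec (dim_row H) u) 0). uniform_state \<psi>) \<and>
      expected_time (run H p (unit_vec (dim_row H) u) 0) \<le> ennreal (pi * real n powr (3 / 2))"
    unfolding dim using p potential_imp_mixing(1)[OF p(3)] by blast
qed

end

theorem theorem2:
  shows "\<exists>C::real. C > 0 \<and>
    (\<forall>(n::nat) (A::complex mat).
      n \<ge> 1 \<longrightarrow> A \<in> carrier_mat n n \<longrightarrow> hermitian_mat A \<longrightarrow>
      simple_eigenvalue A 0 \<longrightarrow> eigenvector A (ones_vec n) 0 \<longrightarrow>
      las_vegas_uniform_mixing (complex_of_real (1 / real n) \<cdot>\<^sub>m cone_mat A)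
        (C * real n powr (3 / 2)))"
\<comment> \<open>The constant \<open>pi\<close> is the one from \<open>time_bound\<close>.\<close>
proof (intro exI[of _ pi] conjI allI impI)
  fix n :: nat and A :: "complex mat"
  assume "n \<ge> 1" "A \<in> carrier_mat n n" "hermitian_mat A" "eigenvector A (ones_vec n) 0"
  then interpret walk_on_cone n A
    by unfold_locales
  show "las_vegas_uniform_mixing (complex_of_real (1 / real n) \<cdot>\<^sub>m cone_mat A) (pi * real n powr (3 / 2))"
    using las_vegas_uniform_mixing_H by (simp add: H_def)
qed simp

end
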